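(* Let $n\ge 1$ be an integer. There exists a constant $c_*>0$, depending only on $n$, such that the following holds. Let $A=[a_{x,y}]_{x,y\in\mathbb Z}$ be any doubly infinite hermitian matrix with complex entries (i.e. $a_{x,y}^*=a_{y,x}$ for all $x,y\in\mathbb Z$) that is an $(nJ)$-matrix, i.e. $$a_{x,y}=0\quad\text{for all } x,y\in\mathbb Z \text{ with } |x-y|>n,$$ and that satisfies $$\limsup_{|x|\to+\infty}\frac{1}{\langle x\rangle}\left(\sum_{y\in\mathbb Z}|a_{x,y}|\right)\le c_*.$$ Then the operator $A:c_0(\mathbb Z)\to\ell_2(\mathbb Z)$ given by $(Af)_x:=\sum_{y\in\mathbb Z}a_{x,y}f_y$, $x\in\mathbb Z$, $f\in c_0(\mathbb Z)$, is essentially self-adjoint on $\ell_2(\mathbb Z)$.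
   Context: Here $a^*$ denotes the complex conjugate of $a\in\mathbb C$, and $\langle a\rangle:=(1+|a|^2)^{1/2}$. The space $\ell_2(\mathbb Z)$ is the complex Hilbert space of doubly infinite complex sequences $f=(f_x)_{x\in\mathbb Z}$ with $\|f\|_{\ell_2(\mathbb Z)}=\left(\sum_x|f_x|^2\right)^{1/2}<+\infty$, and $c_0(\mathbb Z)\subset\ell_2(\mathbb Z)$ denotes the subspace of compactly (finitely) supported sequences. The operator $A$ with domain $c_0(\mathbb Z)$ is symmetric and closable; essentially self-adjoint means that its closure $\bar A:D(\bar A)\to\ell_2(\mathbb Z)$ is self-adjoint. *)

theory Defs
  imports "HOL-Analysis.Analysis"
begin

definition japanese_bracket :: "complex \<Rightarrow> real" where
  "japanese_bracket a = sqrt (1 + (cmod a)\<^sup>2)"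

definition ell2 :: "(int \<Rightarrow> complex) set" where
  "ell2 = {f. (\<lambda>x. (cmod (f x))\<^sup>2) summable_on UNIV}"

definition ell2_norm :: "(int \<Rightarrow> complex) \<Rightarrow> real" where
  "ell2_norm f = sqrt (\<Sum>\<^sub>\<infinity>x. (cmod (f x))\<^sup>2)"

definition ell2_inner :: "(int \<Rightarrow> complex) \<Rightarrow> (int \<Rightarrow> complex) \<Rightarrow> complex" where
  "ell2_inner f g = (\<Sum>\<^sub>\<infinity>x. f x * cnj (g x))"

definition c0 :: "(int \<Rightarrow> complex) set" where
  "c0 = {f. finite {x. f x \<noteq> 0}}"

text \<open>
  A possibly unbounded operator in \<open>ell2\<close> is represented by its graph, so that
  its domain is the library's \<open>Domain G\<close> and equality of operators includes equality of domains.
\<close>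

type_synonym ell2_graph = "((int \<Rightarrow> complex) \<times> (int \<Rightarrow> complex)) set"

definition linear_operator :: "ell2_graph \<Rightarrow> bool" where
  "linear_operator G \<longleftrightarrow>
     G \<subseteq> ell2 \<times> ell2 \<and> single_valued G \<and> (\<lambda>x. 0, \<lambda>x. 0) \<in> G \<and>
     (\<forall>f h f' h' c. (f, h) \<in> G \<longrightarrow> (f', h') \<in> G \<longrightarrow>
        (\<lambda>x. f x + c * f' x, \<lambda>x. h x + c * h' x) \<in> G)"

definition densely_defined :: "ell2_graph \<Rightarrow> bool" where
  "densely_defined G \<longleftrightarrow>
     (\<forall>f\<in>ell2. \<forall>e>0. \<exists>g\<in>Domain G. ell2_norm (\<lambda>x. f x - g x) < e)"

definition op_closure :: "ell2_graph \<Rightarrow> ell2_graph" where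
  "op_closure G = {(f, h). f \<in> ell2 \<and> h \<in> ell2 \<and>
     (\<exists>u v. (\<forall>k::nat. (u k, v k) \<in> G) \<and>
        (\<lambda>k. ell2_norm (\<lambda>x. u k x - f x)) \<longlonglongrightarrow> 0 \<and>
        (\<lambda>k. ell2_norm (\<lambda>x. v k x - h x)) \<longlonglongrightarrow> 0)}"

definition op_adjoint :: "ell2_graph \<Rightarrow> ell2_graph" where
  "op_adjoint G = {(g, h). g \<in> ell2 \<and> h \<in> ell2 \<and>
     (\<forall>f k. (f, k) \<in> G \<longrightarrow> ell2_inner k g = ell2_inner f h)}"

definition self_adjoint :: "ell2_graph \<Rightarrow> bool" where
  "self_adjoint G \<longleftrightarrow> linear_operator G \<and> densely_defined G \<and> op_adjoint G = G"

text \<open>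
  Closability of \<open>G\<close>, i.e. single-valuedness of \<open>op_closure G\<close>, is part of
  \<open>self_adjoint (op_closure G)\<close>.
\<close>

definition essentially_self_adjoint :: "ell2_graph \<Rightarrow> bool" where
  "essentially_self_adjoint G \<longleftrightarrow>
     linear_operator G \<and> densely_defined G \<and> self_adjoint (op_closure G)"

definition hermitian_matrix :: "(int \<Rightarrow> int \<Rightarrow> complex) \<Rightarrow> bool" where
  "hermitian_matrix a \<longleftrightarrow> (\<forall>x y. cnj (a x y) = a y x)"

definition nJ_matrix :: "nat \<Rightarrow> (int \<Rightarrow> int \<Rightarrow> complex) \<Rightarrow> bool" where
  "nJ_matrix n a \<longleftrightarrow> (\<forall>x y. \<bar>x - y\<bar> > int n \<longrightarrow> a x y = 0)"

definition matrix_operator :: "(int \<Rightarrow> int \<Rightarrow> complex) \<Rightarrow> ell2_graph" where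
  "matrix_operator a = {(f, \<lambda>x. \<Sum>\<^sub>\<infinity>y. a x y * f y) | f. f \<in> c0}"

end

theory Submission
  imports Defs
begin

text \<open>
  Every threshold works, because linear growth of the entries already suffices. Let \<open>g\<close> and \<open>A g\<close>
  be square summable, where \<open>A\<close> acts by its matrix. Cut \<open>g\<close> off with \<open>\<chi>\<^sub>R x = max 0 (1 - \<bar>x\<bar> / R)\<close>.
  The commutator of \<open>A\<close> with \<open>\<chi>\<^sub>R\<close> has entries \<open>a x y * (\<chi>\<^sub>R y - \<chi>\<^sub>R x)\<close>; these are bounded uniformly in
  \<open>R\<close>, since the linear growth of \<open>a x y\<close> is compensated by the slope \<open>1 / R\<close> of \<open>\<chi>\<^sub>R\<close>. By dominated
  convergence \<open>A (\<chi>\<^sub>R g)\<close> tends to \<open>A g\<close>, so the closure of the operator on finitely supported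
  sequences is the maximal operator, and the same limit shows that the maximal operator is symmetric.
\<close>

section \<open>Dominated convergence and square summable sequences\<close>

text \<open>Infinite sums are Lebesgue integrals over the counting measure, so dominated convergence
  for integrals applies; integrability of every \<open>f k\<close> and of the limit \<open>l\<close>
  comes from the same domination.\<close>

lemma infsum_dominated_convergence:
  fixes f :: "nat \<Rightarrow> 'a \<Rightarrow> 'b::{banach, second_countable_topology}"
  assumes F: "F summable_on A"
    and lim: "\<And>x. x \<in> A \<Longrightarrow> (\<lambda>k. f k x) \<longlonglongrightarrow> l x"
    and bound: "\<And>k x. x \<in> A \<Longrightarrow> norm (f k x) \<le> F x"
  shows "(\<lambda>k. infsum (f k) A) \<longlonglongrightarrow> infsum l A"
proof -
  have iF: "integrable (count_space A) F"
    using F abs_summable_equivalent[of F A] summable_on_iff_abs_summable_on_real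
    by (auto simp: abs_summable_on_def)
  have meas: "g \<in> borel_measurable (count_space A)" for g :: "'a \<Rightarrow> 'b"
    by simp
  have ae: "AE x in count_space A. (\<lambda>k. f k x) \<longlonglongrightarrow> l x"
    "\<And>k. AE x in count_space A. norm (f k x) \<le> F x"
    using lim bound by (auto simp: AE_count_space)
  note dom = meas meas iF ae
  have "infsum (f k) A = integral\<^sup>L (count_space A) (f k)" for k
    using integrable_dominated_convergence2[OF dom] infsetsum_infsum[of "f k" A]
    by (simp add: abs_summable_on_def infsetsum_def)
  moreover have "infsum l A = integral\<^sup>L (count_space A) l"
    using integrable_dominated_convergence[OF dom] infsetsum_infsum[of l A]
    by (simp add: abs_summable_on_def infsetsum_def)
  ultimately show ?thesis
    using integral_dominated_convergence[OF dom] by simp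
qed

lemma infsum_eq_sum_superset:
  fixes f :: "'a \<Rightarrow> 'b::{comm_monoid_add, t2_space}"
  assumes "finite T" "\<And>x. x \<notin> T \<Longrightarrow> f x = 0"
  shows "(\<Sum>\<^sub>\<infinity>x. f x) = sum f T"
proof -
  have "infsum f UNIV = infsum f T"
    using assms by (intro infsum_cong_neutral) auto
  with assms show ?thesis by simp
qed

lemma square_summable_add:
  fixes f g :: "'a \<Rightarrow> real"
  assumes "(\<lambda>x. (f x)\<^sup>2) summable_on A" "(\<lambda>x. (g x)\<^sup>2) summable_on A"
  shows "(\<lambda>x. (f x + g x)\<^sup>2) summable_on A"
proof (rule summable_on_comparison_test)
  show "(\<lambda>x. 2 * (f x)\<^sup>2 + 2 * (g x)\<^sup>2) summable_on A"
    using assms by (intro summable_on_add summable_on_cmult_right)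
  show "(f x + g x)\<^sup>2 \<le> 2 * (f x)\<^sup>2 + 2 * (g x)\<^sup>2" for x
    using zero_le_power2[of "f x - g x"] by (simp add: power2_sum power2_diff)
qed auto

lemma square_summable_sum:
  fixes f :: "'i \<Rightarrow> 'a \<Rightarrow> real"
  assumes "\<And>i. i \<in> I \<Longrightarrow> (\<lambda>x. (f i x)\<^sup>2) summable_on A"
  shows "(\<lambda>x. (\<Sum>i\<in>I. f i x)\<^sup>2) summable_on A"
  using assms by (induction I rule: infinite_finite_induct) (auto intro: square_summable_add)

lemma square_summable_cmult:
  fixes f :: "'a \<Rightarrow> real"
  assumes "(\<lambda>x. (f x)\<^sup>2) summable_on A"
  shows "(\<lambda>x. (c * f x)\<^sup>2) summable_on A"
  using assms by (auto simp: power_mult_distrib intro: summable_on_cmult_right)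

lemma summable_mult_square_summable:
  fixes f g :: "'a \<Rightarrow> real"
  assumes "(\<lambda>x. (f x)\<^sup>2) summable_on A" "(\<lambda>x. (g x)\<^sup>2) summable_on A"
    and nonneg: "\<And>x. x \<in> A \<Longrightarrow> 0 \<le> f x" "\<And>x. x \<in> A \<Longrightarrow> 0 \<le> g x"
  shows "(\<lambda>x. f x * g x) summable_on A"
proof (rule summable_on_comparison_test)
  show "(\<lambda>x. (f x)\<^sup>2 + (g x)\<^sup>2) summable_on A"
    using assms by (intro summable_on_add)
  show "f x * g x \<le> (f x)\<^sup>2 + (g x)\<^sup>2" if "x \<in> A" for x
    using sum_squares_bound[of "f x" "g x"] mult_nonneg_nonneg[OF nonneg[OF that]] by linarith
qed (use nonneg in auto)

lemma ell2I_bound: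
  assumes "(\<lambda>x. (F x)\<^sup>2) summable_on UNIV" "\<And>x. cmod (f x) \<le> F x"
  shows "f \<in> ell2"
  unfolding ell2_def mem_Collect_eq
  using assms(1) by (rule summable_on_comparison_test) (auto intro: power_mono assms(2))

lemma ell2_add_cmult:
  assumes "f \<in> ell2" "g \<in> ell2"
  shows "(\<lambda>x. f x + c * g x) \<in> ell2"
proof (rule ell2I_bound)
  show "(\<lambda>x. (cmod (f x) + cmod c * cmod (g x))\<^sup>2) summable_on UNIV"
    using assms by (auto simp: ell2_def intro!: square_summable_add square_summable_cmult)
  show "cmod (f x + c * g x) \<le> cmod (f x) + cmod c * cmod (g x)" for x
    by (metis norm_mult norm_triangle_ineq)
qed

lemma ell2_diff: "f \<in> ell2 \<Longrightarrow> g \<in> ell2 \<Longrightarrow> (\<lambda>x. f x - g x) \<in> ell2"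
  using ell2_add_cmult[of f g "-1"] by simp

lemma c0_subset_ell2: "c0 \<subseteq> ell2"
proof
  fix f :: "int \<Rightarrow> complex"
  assume "f \<in> c0"
  then have "finite {x. f x \<noteq> 0}"
    by (simp add: c0_def)
  moreover have "(\<lambda>x. (cmod (f x))\<^sup>2) summable_on {x. f x \<noteq> 0} \<longleftrightarrow> (\<lambda>x. (cmod (f x))\<^sup>2) summable_on UNIV"
    by (rule summable_on_cong_neutral) auto
  ultimately show "f \<in> ell2"
    by (simp add: ell2_def)
qed

lemma cmod_le_ell2_norm:
  assumes "f \<in> ell2"
  shows "cmod (f x) \<le> ell2_norm f"
proof -
  have "(\<Sum>y\<in>{x}. (cmod (f y))\<^sup>2) \<le> (\<Sum>\<^sub>\<infinity>y. (cmod (f y))\<^sup>2)"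
    using assms by (intro finite_sum_le_infsum) (auto simp: ell2_def)
  then show ?thesis
    unfolding ell2_norm_def by (auto intro: real_le_rsqrt)
qed

text \<open>Evaluation at a coordinate is bounded by the norm. This identifies the limits of
  approximating sequences when the closure is computed.\<close>

lemma ell2_norm_tendsto_imp_pointwise:
  assumes "\<And>k. u k \<in> ell2" "f \<in> ell2" "(\<lambda>k. ell2_norm (\<lambda>x. u k x - f x)) \<longlonglongrightarrow> 0"
  shows "(\<lambda>k. u k x) \<longlonglongrightarrow> f x"
proof -
  have "(\<lambda>k. u k x - f x) \<longlonglongrightarrow> 0"
    by (rule Lim_null_comparison[OF _ assms(3)])
      (use cmod_le_ell2_norm[OF ell2_diff[OF assms(1,2)]] in auto)
  then show ?thesis
    by (simp add: LIM_zero_iff)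
qed

text \<open>The squared differences tend to 0 at each coordinate and lie below the summable
  \<open>(F x + cmod (f x))\<close>-squares, so their sums tend to 0.\<close>

lemma ell2_norm_tendsto_dominated:
  assumes F: "(\<lambda>x. (F x)\<^sup>2) summable_on UNIV" and f: "f \<in> ell2"
    and lim: "\<And>x. (\<lambda>k. u k x) \<longlonglongrightarrow> f x"
    and bound: "\<And>k x. cmod (u k x) \<le> F x"
  shows "(\<lambda>k. ell2_norm (\<lambda>x. u k x - f x)) \<longlonglongrightarrow> 0"
proof -
  have "(\<lambda>k. \<Sum>\<^sub>\<infinity>x. (cmod (u k x - f x))\<^sup>2) \<longlonglongrightarrow> (\<Sum>\<^sub>\<infinity>x::int. 0)"
  proof (rule infsum_dominated_convergence)
    show "(\<lambda>x. (F x + cmod (f x))\<^sup>2) summable_on UNIV"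
      using F f by (auto simp: ell2_def intro: square_summable_add)
    show "(\<lambda>k. (cmod (u k x - f x))\<^sup>2) \<longlonglongrightarrow> 0" for x
      using tendsto_power[OF tendsto_norm[OF LIM_zero[OF lim]], of x 2] by simp
    have "cmod (u k x - f x) \<le> F x + cmod (f x)" for k x
      using norm_triangle_ineq4[of "u k x" "f x"] bound[of k x] by linarith
    then show "norm ((cmod (u k x - f x))\<^sup>2) \<le> (F x + cmod (f x))\<^sup>2" for k x
      by (simp add: power_mono)
  qed
  from tendsto_real_sqrt[OF this] show ?thesis
    by (simp add: ell2_norm_def)
qed

lemma ell2_inner_tendsto_dominated:
  assumes F: "(\<lambda>x. (F x)\<^sup>2) summable_on UNIV" and g: "g \<in> ell2"
    and lim: "\<And>x. (\<lambda>k. u k x) \<longlonglongrightarrow> f x"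
    and bound: "\<And>k x. cmod (u k x) \<le> F x"
  shows "(\<lambda>k. ell2_inner (u k) g) \<longlonglongrightarrow> ell2_inner f g"
  unfolding ell2_inner_def
proof (rule infsum_dominated_convergence)
  \<comment> \<open>Nonnegativity of the majorant follows from its dominating a norm, already at
    \<open>k = 0\<close>.\<close>
  have "0 \<le> F x" for x
    using bound[of 0 x] norm_ge_zero order_trans by blast
  with F g show "(\<lambda>x. F x * cmod (g x)) summable_on UNIV"
    by (intro summable_mult_square_summable) (auto simp: ell2_def)
  show "(\<lambda>k. u k x * cnj (g x)) \<longlonglongrightarrow> f x * cnj (g x)" for x
    by (intro tendsto_mult lim tendsto_const)
  show "norm (u k x * cnj (g x)) \<le> F x * cmod (g x)" for k x
    by (simp add: norm_mult bound mult_right_mono)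
qed

section \<open>Cutoff functions\<close>

text \<open>A tent function instead of a sharp truncation: with an indicator function the commutator
  entries near the edge could be of order \<open>R\<close>.\<close>

definition cutoff :: "real \<Rightarrow> int \<Rightarrow> real" where
  "cutoff R x = max 0 (1 - \<bar>of_int x\<bar> / R)"

lemma cutoff_bounds: "R > 0 \<Longrightarrow> 0 \<le> cutoff R x" "R > 0 \<Longrightarrow> cutoff R x \<le> 1"
  by (auto simp: cutoff_def)

lemma cutoff_eq_0: "R > 0 \<Longrightarrow> R \<le> \<bar>of_int x\<bar> \<Longrightarrow> cutoff R x = 0"
  by (auto simp: cutoff_def field_simps)

text \<open>Taking the maximum with 0 does not increase distances, and the rest is the reverse
  triangle inequality.\<close>

lemma cutoff_lipschitz:
  assumes "R > 0"
  shows "\<bar>cutoff R y - cutoff R x\<bar> \<le> \<bar>of_int (x - y)\<bar> / R"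
proof -
  have "\<bar>cutoff R y - cutoff R x\<bar> \<le> \<bar>(1 - \<bar>of_int y\<bar> / R) - (1 - \<bar>of_int x\<bar> / R)\<bar>"
    unfolding cutoff_def by (simp add: max_def)
  also have "\<dots> = \<bar>\<bar>of_int x\<bar> - \<bar>of_int y\<bar>\<bar> / R"
    using assms by (simp flip: diff_divide_distrib)
  also have "\<dots> \<le> \<bar>of_int (x - y)\<bar> / R"
    using assms by (intro divide_right_mono) auto
  finally show ?thesis .
qed

lemma finite_cutoff_support: "R > 0 \<Longrightarrow> finite {x. cutoff R x \<noteq> 0}"
proof (rule finite_subset)
  assume "R > 0"
  show "{x. cutoff R x \<noteq> 0} \<subseteq> {- \<lceil>R\<rceil>..\<lceil>R\<rceil>}"
  proof
    fix x
    assume "x \<in> {x. cutoff R x \<noteq> 0}"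
    with \<open>R > 0\<close> have "\<bar>of_int x\<bar> < R"
      using cutoff_eq_0[of R x] by force
    then have "\<bar>x\<bar> \<le> \<lceil>R\<rceil>"
      by linarith
    then show "x \<in> {- \<lceil>R\<rceil>..\<lceil>R\<rceil>}"
      by auto
  qed
qed auto

text \<open>The radii are \<open>Suc k\<close>, so that each of them is at least 1, as the
  commutator estimate requires.\<close>

lemma cutoff_tendsto_1: "(\<lambda>k. cutoff (real (Suc k)) x) \<longlonglongrightarrow> 1"
proof -
  have "(\<lambda>k. max 0 (1 - \<bar>real_of_int x\<bar> * inverse (real (Suc k)))) \<longlonglongrightarrow> max 0 (1 - \<bar>real_of_int x\<bar> * 0)"
    by (intro tendsto_intros LIMSEQ_inverse_real_of_nat)
  then show ?thesis
    by (simp add: cutoff_def divide_inverse)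
qed

lemma cutoff_mult_in_c0: "R > 0 \<Longrightarrow> (\<lambda>x. of_real (cutoff R x) * g x) \<in> c0"
  unfolding c0_def mem_Collect_eq
  by (rule finite_subset[OF _ finite_cutoff_support]) auto

lemma norm_cutoff_mult_le: "R > 0 \<Longrightarrow> cmod (of_real (cutoff R x) * z) \<le> cmod z"
  using cutoff_bounds[of R x] by (simp add: norm_mult mult_left_le_one_le)

lemma cutoff_mult_tendsto: "(\<lambda>k. of_real (cutoff (real (Suc k)) x) * z) \<longlonglongrightarrow> (z :: complex)"
  using tendsto_mult[OF tendsto_of_real[OF cutoff_tendsto_1] tendsto_const, of x z] by simp

text \<open>The cutoffs of \<open>f\<close> are finitely supported, converge pointwise to
  \<open>f\<close> and are dominated by the modulus of \<open>f\<close>.\<close>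

lemma ell2_approx_c0:
  assumes "f \<in> ell2" "e > 0"
  shows "\<exists>g\<in>c0. ell2_norm (\<lambda>x. f x - g x) < e"
proof -
  define u where "u k x = of_real (cutoff (real (Suc k)) x) * f x" for k :: nat and x
  have "(\<lambda>k. ell2_norm (\<lambda>x. u k x - f x)) \<longlonglongrightarrow> 0"
  proof (rule ell2_norm_tendsto_dominated)
    show "(\<lambda>x. (cmod (f x))\<^sup>2) summable_on UNIV"
      using assms by (simp add: ell2_def)
  qed (use assms in \<open>auto simp del: of_nat_Suc simp: u_def intro: cutoff_mult_tendsto norm_cutoff_mult_le\<close>)
  from order_tendstoD(2)[OF this \<open>e > 0\<close>] obtain k where "ell2_norm (\<lambda>x. u k x - f x) < e"
    by (auto simp: eventually_sequentially)
  then have "ell2_norm (\<lambda>x. f x - u k x) < e"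
    by (simp add: ell2_norm_def norm_minus_commute)
  moreover have "u k \<in> c0"
    unfolding u_def by (rule cutoff_mult_in_c0) simp
  ultimately show ?thesis
    by blast
qed

section \<open>Hermitian band matrices with linearly growing entries\<close>

locale linear_growth_band =
  fixes n :: nat and a :: "int \<Rightarrow> int \<Rightarrow> complex" and K :: real
  assumes hermitian: "hermitian_matrix a"
    and band: "nJ_matrix n a"
    and growth: "\<And>x y. cmod (a x y) \<le> K * (1 + \<bar>of_int x\<bar>)"
begin

text \<open>The band condition leaves finitely many nonzero terms in each row, so this is meaningful
  for every sequence, square summable or not.\<close>

definition app :: "(int \<Rightarrow> complex) \<Rightarrow> int \<Rightarrow> complex" where
  "app g x = (\<Sum>\<^sub>\<infinity>y. a x y * g y)"

text \<open>The domain is restricted only by requiring that the image be square summable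
  again.\<close>

definition maximal_operator :: ell2_graph where
  "maximal_operator = {(g, h). g \<in> ell2 \<and> h \<in> ell2 \<and> h = app g}"

lemma matrix_operator_eq: "matrix_operator a = {(f, app f) | f. f \<in> c0}"
  by (simp add: matrix_operator_def app_def[abs_def])

lemma entry_eq_0: "\<bar>x - y\<bar> > int n \<Longrightarrow> a x y = 0"
  using band by (simp add: nJ_matrix_def)

lemma cnj_entry: "cnj (a x y) = a y x"
  using hermitian by (simp add: hermitian_matrix_def)

lemma app_eq_sum: "app g x = (\<Sum>y\<in>{x - int n..x + int n}. a x y * g y)"
  unfolding app_def by (rule infsum_eq_sum_superset) (auto intro!: entry_eq_0)

lemma app_add_cmult: "app (\<lambda>x. f x + c * g x) = (\<lambda>x. app f x + c * app g x)"
  by (simp add: app_eq_sum fun_eq_iff distrib_left sum.distrib sum_distrib_left mult.left_commute)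

lemma app_eq_0_outside:
  assumes "\<And>y. y \<notin> S \<Longrightarrow> f y = 0" "x \<notin> (\<Union>y\<in>S. {y - int n..y + int n})"
  shows "app f x = 0"
  unfolding app_eq_sum
proof (rule sum.neutral, safe)
  fix y
  assume y: "y \<in> {x - int n..x + int n}"
  then have "x \<in> {y - int n..y + int n}"
    by auto
  with assms(2) have "y \<notin> S"
    by blast
  with assms(1) show "a x y * f y = 0"
    by simp
qed

lemma app_c0:
  assumes "f \<in> c0"
  shows "app f \<in> c0"
proof -
  let ?S = "{x. f x \<noteq> 0}"
  have "{x. app f x \<noteq> 0} \<subseteq> (\<Union>y\<in>?S. {y - int n..y + int n})"
    using app_eq_0_outside[of ?S f] by blast
  moreover have "finite ?S"
    using assms by (simp add: c0_def)
  ultimately show ?thesis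
    unfolding c0_def by (auto intro: finite_subset)
qed

text \<open>Finite support of \<open>u\<close> reduces both sides to finite double sums; these can
  be interchanged, and hermitian symmetry matches the entries. Hence \<open>g\<close> can be an
  arbitrary sequence.\<close>

lemma ell2_inner_app_c0:
  assumes "u \<in> c0"
  shows "ell2_inner (app u) g = ell2_inner u (app g)"
proof -
  define S where "S = {x. u x \<noteq> 0}"
  \<comment> \<open>The \<open>n\<close>-neighbourhood of the support contains both the support of
    \<open>app u\<close> and every column reached from a row in \<open>S\<close>.\<close>
  define T where "T = (\<Union>y\<in>S. {y - int n..y + int n})"
  have S: "finite S" and T: "finite T"
    using assms by (simp_all add: S_def T_def c0_def)
  have u: "u x = 0" if "x \<notin> S" for x
    using that by (simp add: S_def)
  have "ell2_inner (app u) g = (\<Sum>x\<in>T. app u x * cnj (g x))"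
    unfolding ell2_inner_def
    by (rule infsum_eq_sum_superset[OF T]) (use app_eq_0_outside[OF u] in \<open>auto simp: T_def\<close>)
  also have "\<dots> = (\<Sum>x\<in>T. \<Sum>y\<in>S. a x y * u y * cnj (g x))"
    unfolding app_def sum_distrib_right[symmetric]
    by (intro sum.cong refl arg_cong2[of _ _ _ _ "(*)"] infsum_eq_sum_superset[OF S]) (simp add: u)
  also have "\<dots> = (\<Sum>y\<in>S. \<Sum>x\<in>T. a x y * u y * cnj (g x))"
    by (rule sum.swap)
  also have "\<dots> = (\<Sum>y\<in>S. u y * cnj (app g y))"
  proof (rule sum.cong[OF refl])
    fix y
    assume "y \<in> S"
    have "app g y = (\<Sum>x\<in>T. a y x * g x)"
      unfolding app_def
    proof (rule infsum_eq_sum_superset[OF T])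
      fix x
      assume "x \<notin> T"
      with \<open>y \<in> S\<close> have "x \<notin> {y - int n..y + int n}"
        by (auto simp: T_def)
      then show "a y x * g x = 0"
        using entry_eq_0[of y x] by auto
    qed
    then show "(\<Sum>x\<in>T. a x y * u y * cnj (g x)) = u y * cnj (app g y)"
      by (simp add: cnj_entry sum_distrib_left mult_ac)
  qed
  also have "\<dots> = ell2_inner u (app g)"
    unfolding ell2_inner_def by (rule infsum_eq_sum_superset[OF S, symmetric]) (simp add: u)
  finally show ?thesis .
qed

section \<open>The commutator with a cutoff\<close>

lemma growth_constant_nonneg: "0 \<le> K"
  using order_trans[OF norm_ge_zero growth[of 0 0]] by simp

text \<open>Product of the entry bound \<open>K * (n + 2) * R\<close> near the support of the cutoff
  and the variation \<open>n / R\<close> of the cutoff across the band; \<open>R\<close>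
  cancels.\<close>

definition commutator_bound :: real where
  "commutator_bound = K * (real n + 2) * real n"

lemma commutator_bound_nonneg: "0 \<le> commutator_bound"
  using growth_constant_nonneg by (simp add: commutator_bound_def)

text \<open>Off the band, or with both indices beyond \<open>R\<close>, the product vanishes.
  Otherwise one index lies within \<open>R\<close>, hence \<open>x\<close> within
  \<open>R + n\<close>, where growth and slope compensate each other.\<close>

lemma commutator_entry_le:
  assumes R: "R \<ge> 1"
  shows "cmod (a x y) * \<bar>cutoff R y - cutoff R x\<bar> \<le> commutator_bound"
proof (cases "\<bar>x - y\<bar> > int n \<or> (R \<le> \<bar>of_int x\<bar> \<and> R \<le> \<bar>of_int y\<bar>)")
  case True
  then have "cmod (a x y) * \<bar>cutoff R y - cutoff R x\<bar> = 0"
    using R by (auto simp: entry_eq_0 cutoff_eq_0)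
  with commutator_bound_nonneg show ?thesis
    by linarith
next
  case False
  then have xy: "\<bar>of_int (x - y)\<bar> \<le> real n" and "\<bar>of_int x\<bar> < R \<or> \<bar>of_int y\<bar> < R"
    by linarith+
  then have "\<bar>of_int x\<bar> \<le> R + real n"
    by auto
  \<comment> \<open>Since \<open>R\<close> is at least 1, both 1 and \<open>n\<close> can be scaled
    up by the factor \<open>R\<close>.\<close>
  then have "1 + \<bar>of_int x\<bar> \<le> (real n + 2) * R"
    using R mult_left_mono[of 1 R "real n"] by (simp add: algebra_simps)
  then have "cmod (a x y) \<le> K * ((real n + 2) * R)"
    using growth[of x y] growth_constant_nonneg mult_left_mono order_trans by blast
  moreover have "\<bar>cutoff R y - cutoff R x\<bar> \<le> real n / R"
    using cutoff_lipschitz[of R y x] divide_right_mono[OF xy, of R] R by linarith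
  ultimately have "cmod (a x y) * \<bar>cutoff R y - cutoff R x\<bar> \<le> K * ((real n + 2) * R) * (real n / R)"
    using R growth_constant_nonneg by (intro mult_mono) auto
  also have "\<dots> = commutator_bound"
    using R by (simp add: commutator_bound_def)
  finally show ?thesis .
qed

text \<open>Independent of the radius. Summing over offsets \<open>d\<close> exhibits the commutator
  part as finitely many translates of \<open>g\<close>, whose square summability is inherited from
  \<open>g\<close>.\<close>

definition majorant :: "(int \<Rightarrow> complex) \<Rightarrow> int \<Rightarrow> real" where
  "majorant g x = cmod (app g x) + commutator_bound * (\<Sum>d\<in>{- int n..int n}. cmod (g (x + d)))"

text \<open>Commuting the cutoff past the matrix gives the cutoff of \<open>app g\<close>, bounded
  by \<open>app g\<close> itself, plus the commutator applied to \<open>g\<close>, bounded entry by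
  entry.\<close>

lemma norm_app_cutoff_le:
  assumes "R \<ge> 1"
  shows "cmod (app (\<lambda>y. of_real (cutoff R y) * g y) x) \<le> majorant g x"
proof -
  let ?I = "{x - int n..x + int n}"
  have "app (\<lambda>y. of_real (cutoff R y) * g y) x = of_real (cutoff R x) * app g x +
      (\<Sum>y\<in>?I. a x y * of_real (cutoff R y - cutoff R x) * g y)"
    by (simp add: app_eq_sum sum_distrib_left sum.distrib[symmetric] algebra_simps)
  moreover have "cmod (of_real (cutoff R x) * app g x) \<le> cmod (app g x)"
    using assms by (intro norm_cutoff_mult_le) simp
  moreover have "cmod (\<Sum>y\<in>?I. a x y * of_real (cutoff R y - cutoff R x) * g y)
      \<le> (\<Sum>y\<in>?I. commutator_bound * cmod (g y))"
  proof (rule sum_norm_le)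
    fix y
    have "cmod (a x y * of_real (cutoff R y - cutoff R x)) \<le> commutator_bound"
      unfolding norm_mult norm_of_real by (rule commutator_entry_le[OF assms])
    then show "cmod (a x y * of_real (cutoff R y - cutoff R x) * g y) \<le> commutator_bound * cmod (g y)"
      unfolding norm_mult[of _ "g y"] by (rule mult_right_mono) simp
  qed
  moreover have "(\<Sum>y\<in>?I. cmod (g y)) = (\<Sum>d\<in>{- int n..int n}. cmod (g (x + d)))"
    by (rule sum.reindex_bij_witness[of _ "\<lambda>d. x + d" "\<lambda>y. y - x"]) auto
  ultimately show ?thesis
    unfolding majorant_def sum_distrib_left[symmetric]
    by (metis (no_types, lifting) add_mono norm_triangle_le)
qed

lemma majorant_square_summable:
  assumes "g \<in> ell2" "app g \<in> ell2"
  shows "(\<lambda>x. (majorant g x)\<^sup>2) summable_on UNIV"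
proof -
  have "(\<lambda>x. (cmod (g (x + d)))\<^sup>2) summable_on UNIV" for d
    using assms(1) summable_on_reindex_bij_witness[of UNIV "\<lambda>x. x - d" "\<lambda>x. x + d" UNIV
        "\<lambda>x. (cmod (g x))\<^sup>2" "\<lambda>x. (cmod (g (x + d)))\<^sup>2"]
    by (simp add: ell2_def)
  then show ?thesis
    using assms(2) unfolding majorant_def ell2_def
    by (auto intro!: square_summable_add square_summable_cmult square_summable_sum)
qed

lemma app_cutoff_tendsto:
  "(\<lambda>k. app (\<lambda>y. of_real (cutoff (real (Suc k)) y) * g y) x) \<longlonglongrightarrow> app g x"
  unfolding app_eq_sum by (intro tendsto_sum tendsto_mult_left cutoff_mult_tendsto)

section \<open>Closure and adjoint\<close>

text \<open>Norm limits are coordinatewise limits, and these pass through the finite row sums, so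
  the closure acts by the matrix. Conversely, cutoffs approximate each element of the maximal domain
  together with its image, thanks to \<open>majorant\<close>.\<close>

lemma op_closure_matrix_operator: "op_closure (matrix_operator a) = maximal_operator"
proof (intro subset_antisym subrelI)
  fix f h
  assume "(f, h) \<in> op_closure (matrix_operator a)"
  then obtain u v where f: "f \<in> ell2" and h: "h \<in> ell2"
    and uv: "\<And>k::nat. (u k, v k) \<in> matrix_operator a"
    and lim: "(\<lambda>k. ell2_norm (\<lambda>x. u k x - f x)) \<longlonglongrightarrow> 0" "(\<lambda>k. ell2_norm (\<lambda>x. v k x - h x)) \<longlonglongrightarrow> 0"
    unfolding op_closure_def by auto
  have u: "u k \<in> c0" and v: "v k = app (u k)" for k
    using uv[of k] by (auto simp: matrix_operator_eq)
  have "h x = app f x" for x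
  proof (rule LIMSEQ_unique)
    show "(\<lambda>k. v k x) \<longlonglongrightarrow> h x"
      using u v h lim(2) app_c0 c0_subset_ell2 by (intro ell2_norm_tendsto_imp_pointwise) auto
    have "(\<lambda>k. u k y) \<longlonglongrightarrow> f y" for y
      using u f lim(1) c0_subset_ell2 by (intro ell2_norm_tendsto_imp_pointwise) auto
    then show "(\<lambda>k. v k x) \<longlonglongrightarrow> app f x"
      unfolding v app_eq_sum by (intro tendsto_sum tendsto_mult_left)
  qed
  with f h show "(f, h) \<in> maximal_operator"
    by (auto simp: maximal_operator_def)
next
  fix g h
  assume "(g, h) \<in> maximal_operator"
  then have g: "g \<in> ell2" and h: "h \<in> ell2" "h = app g"
    by (auto simp: maximal_operator_def)
  define u where "u k y = of_real (cutoff (real (Suc k)) y) * g y" for k :: nat and y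
  have "(u k, app (u k)) \<in> matrix_operator a" for k
    using cutoff_mult_in_c0[of "real (Suc k)" g] by (auto simp: matrix_operator_eq u_def[abs_def])
  moreover have "(\<lambda>k. ell2_norm (\<lambda>x. u k x - g x)) \<longlonglongrightarrow> 0"
  proof (rule ell2_norm_tendsto_dominated)
    show "(\<lambda>x. (cmod (g x))\<^sup>2) summable_on UNIV"
      using g by (simp add: ell2_def)
  qed (use g in \<open>auto simp del: of_nat_Suc simp: u_def intro: cutoff_mult_tendsto norm_cutoff_mult_le\<close>)
  moreover have "(\<lambda>k. ell2_norm (\<lambda>x. app (u k) x - h x)) \<longlonglongrightarrow> 0"
  proof (rule ell2_norm_tendsto_dominated)
    show "(\<lambda>x. (majorant g x)\<^sup>2) summable_on UNIV"
      using g h by (intro majorant_square_summable) auto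
    show "h \<in> ell2"
      by (fact h)
    show "(\<lambda>k. app (u k) x) \<longlonglongrightarrow> h x" for x
      unfolding u_def h(2) by (rule app_cutoff_tendsto)
    show "cmod (app (u k) x) \<le> majorant g x" for k x
      unfolding u_def by (rule norm_app_cutoff_le) simp
  qed
  ultimately show "(g, h) \<in> op_closure (matrix_operator a)"
    unfolding op_closure_def using g h(1)
    by (intro CollectI case_prodI conjI exI[of _ u] exI[where x = "\<lambda>k. app (u k)"]) auto
qed

text \<open>For cutoffs of \<open>f\<close> the identity is exact by
  \<open>ell2_inner_app_c0\<close>. Both sides converge by domination, with
  \<open>majorant f\<close> on the left and the modulus of \<open>f\<close> on the right.\<close>

lemma maximal_operator_symmetric:
  assumes f: "f \<in> ell2" "app f \<in> ell2" and g: "g \<in> ell2" "app g \<in> ell2"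
  shows "ell2_inner (app f) g = ell2_inner f (app g)"
proof (rule LIMSEQ_unique)
  define u where "u k y = of_real (cutoff (real (Suc k)) y) * f y" for k :: nat and y
  have u: "u k \<in> c0" for k
    unfolding u_def by (rule cutoff_mult_in_c0) simp
  show "(\<lambda>k. ell2_inner (app (u k)) g) \<longlonglongrightarrow> ell2_inner (app f) g"
  proof (rule ell2_inner_tendsto_dominated)
    show "(\<lambda>x. (majorant f x)\<^sup>2) summable_on UNIV"
      using f by (rule majorant_square_summable)
    show "(\<lambda>k. app (u k) x) \<longlonglongrightarrow> app f x" for x
      unfolding u_def by (rule app_cutoff_tendsto)
    show "cmod (app (u k) x) \<le> majorant f x" for k x
      unfolding u_def by (rule norm_app_cutoff_le) simp
  qed (fact g)
  have "(\<lambda>k. ell2_inner (u k) (app g)) \<longlonglongrightarrow> ell2_inner f (app g)"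
  proof (rule ell2_inner_tendsto_dominated)
    show "(\<lambda>x. (cmod (f x))\<^sup>2) summable_on UNIV"
      using f by (simp add: ell2_def)
  qed (use g in \<open>auto simp del: of_nat_Suc simp: u_def intro: cutoff_mult_tendsto norm_cutoff_mult_le\<close>)
  then show "(\<lambda>k. ell2_inner (app (u k)) g) \<longlonglongrightarrow> ell2_inner f (app g)"
    by (simp add: ell2_inner_app_c0[OF u])
qed

lemma matrix_operator_subset_maximal: "matrix_operator a \<subseteq> maximal_operator"
  using app_c0 c0_subset_ell2 by (auto simp: matrix_operator_eq maximal_operator_def)

text \<open>Testing against unit vectors shows that the adjoint acts by the same matrix; the other
  inclusion is symmetry.\<close>

lemma op_adjoint_maximal_operator: "op_adjoint maximal_operator = maximal_operator"
proof (intro subset_antisym subrelI)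
  fix g h
  assume gh: "(g, h) \<in> op_adjoint maximal_operator"
  have "h x = app g x" for x
  proof -
    define \<delta> :: "int \<Rightarrow> complex" where "\<delta> = (\<lambda>y. if y = x then 1 else 0)"
    have \<delta>: "\<delta> \<in> c0"
      by (simp add: c0_def \<delta>_def)
    have inner: "ell2_inner \<delta> k = cnj (k x)" for k
      unfolding ell2_inner_def by (subst infsum_eq_sum_superset[of "{x}"]) (auto simp: \<delta>_def)
    from \<delta> have "(\<delta>, app \<delta>) \<in> maximal_operator"
      using matrix_operator_subset_maximal by (auto simp: matrix_operator_eq)
    with gh have "ell2_inner (app \<delta>) g = ell2_inner \<delta> h"
      by (auto simp: op_adjoint_def)
    then have "cnj (app g x) = cnj (h x)"
      by (simp add: ell2_inner_app_c0[OF \<delta>] inner)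
    then show ?thesis
      by simp
  qed
  with gh show "(g, h) \<in> maximal_operator"
    by (auto simp: op_adjoint_def maximal_operator_def)
next
  fix g h
  assume "(g, h) \<in> maximal_operator"
  then show "(g, h) \<in> op_adjoint maximal_operator"
    using maximal_operator_symmetric by (auto simp: op_adjoint_def maximal_operator_def)
qed

section \<open>Linearity and dense domains\<close>

lemma zero_c0: "(\<lambda>x. 0) \<in> c0"
  by (simp add: c0_def)

lemma app_zero: "app (\<lambda>x. 0) = (\<lambda>x. 0)"
  by (simp add: app_def[abs_def])

lemma c0_add_cmult: "f \<in> c0 \<Longrightarrow> g \<in> c0 \<Longrightarrow> (\<lambda>x. f x + c * g x) \<in> c0"
  unfolding c0_def mem_Collect_eq
  by (rule finite_subset[of _ "{x. f x \<noteq> 0} \<union> {x. g x \<noteq> 0}"]) auto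

lemma linear_operator_matrix_operator: "linear_operator (matrix_operator a)"
  unfolding linear_operator_def
proof (intro conjI allI impI)
  show "matrix_operator a \<subseteq> ell2 \<times> ell2"
    using matrix_operator_subset_maximal by (auto simp: maximal_operator_def)
  show "single_valued (matrix_operator a)"
    by (auto simp: single_valued_def matrix_operator_eq)
  show "(\<lambda>x. 0, \<lambda>x. 0) \<in> matrix_operator a"
    using zero_c0 app_zero by (auto simp: matrix_operator_eq)
qed (auto simp: matrix_operator_eq app_add_cmult c0_add_cmult)

lemma linear_operator_maximal_operator: "linear_operator maximal_operator"
  unfolding linear_operator_def
proof (intro conjI allI impI)
  show "single_valued maximal_operator"
    by (auto simp: single_valued_def maximal_operator_def)
  show "(\<lambda>x. 0, \<lambda>x. 0) \<in> maximal_operator"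
    using zero_c0 c0_subset_ell2 by (auto simp: maximal_operator_def app_zero)
qed (auto simp: maximal_operator_def app_add_cmult ell2_add_cmult)

lemma densely_defined_matrix_operator: "densely_defined (matrix_operator a)"
proof -
  have "Domain (matrix_operator a) = c0"
    by (auto simp: matrix_operator_eq)
  then show ?thesis
    by (simp add: densely_defined_def ell2_approx_c0)
qed

lemma densely_defined_maximal_operator: "densely_defined maximal_operator"
  using densely_defined_matrix_operator Domain_mono[OF matrix_operator_subset_maximal]
  unfolding densely_defined_def by (meson subsetD)

theorem essentially_self_adjoint_matrix_operator: "essentially_self_adjoint (matrix_operator a)"
  unfolding essentially_self_adjoint_def self_adjoint_def op_closure_matrix_operator
  using linear_operator_matrix_operator densely_defined_matrix_operator
    linear_operator_maximal_operator densely_defined_maximal_operator op_adjoint_maximal_operator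
  by blast

end

section \<open>From the limsup condition to linear growth\<close>

text \<open>Each entry is at most its absolute row sum. The limsup controls all rows beyond some
  \<open>N\<close>, and the finitely many others are absorbed into the constant.\<close>

lemma growth_from_Limsup:
  assumes band: "nJ_matrix n a"
    and lim: "Limsup (filtercomap (\<lambda>x::int. \<bar>x\<bar>) at_top)
      (\<lambda>x. ereal (1 / japanese_bracket (of_int x) * (\<Sum>\<^sub>\<infinity>y. cmod (a x y)))) \<le> ereal c"
  obtains K where "\<And>x y. cmod (a x y) \<le> K * (1 + \<bar>of_int x\<bar>)"
proof -
  define s where "s x = (\<Sum>\<^sub>\<infinity>y. cmod (a x y))" for x
  have s: "s x = (\<Sum>y\<in>{x - int n..x + int n}. cmod (a x y))" for x
    unfolding s_def using band by (intro infsum_eq_sum_superset) (auto simp: nJ_matrix_def)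
  have s_nonneg: "0 \<le> s x" for x
    unfolding s by (rule sum_nonneg) simp
  have entry: "cmod (a x y) \<le> s x" for x y
  proof (cases "y \<in> {x - int n..x + int n}")
    case True
    then show ?thesis
      unfolding s by (intro member_le_sum) auto
  next
    case False
    then have "a x y = 0"
      using band by (auto simp: nJ_matrix_def)
    with s_nonneg show ?thesis
      by simp
  qed
  \<comment> \<open>A slack of 1 turns the bound on the limsup into an eventual strict
    bound.\<close>
  have "ereal c < ereal (c + 1)"
    by simp
  with lim have "\<forall>\<^sub>F x in filtercomap (\<lambda>x::int. \<bar>x\<bar>) at_top.
      ereal (1 / japanese_bracket (of_int x) * s x) < ereal (c + 1)"
    unfolding s_def by (intro Limsup_lessD) (rule le_less_trans)
  then obtain N where N: "\<And>x. N \<le> \<bar>x\<bar> \<Longrightarrow> 1 / japanese_bracket (of_int x) * s x < c + 1"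
    by (auto simp: eventually_filtercomap_at_top_linorder)
  \<comment> \<open>The first summand serves the far rows, the second the near ones; absolute values
    avoid case distinctions on the signs of \<open>c + 1\<close> and \<open>N\<close>.\<close>
  define K where "K = \<bar>c + 1\<bar> + (\<Sum>x\<in>{- \<bar>N\<bar>..\<bar>N\<bar>}. s x)"
  have "s x \<le> K * (1 + \<bar>of_int x\<bar>)" for x
  proof (cases "N \<le> \<bar>x\<bar>")
    case True
    define J where "J = japanese_bracket (of_int x)"
    have J: "0 < J" "J \<le> 1 + \<bar>of_int x\<bar>"
      using sqrt_add_le_add_sqrt[of 1 "(real_of_int x)\<^sup>2"]
      by (auto simp: J_def japanese_bracket_def add_pos_nonneg)
    have "s x \<le> (c + 1) * J"
      using N[OF True] J(1) by (simp add: J_def[symmetric] field_simps)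
    also have "\<dots> \<le> K * (1 + \<bar>of_int x\<bar>)"
      using J s_nonneg by (intro mult_mono) (auto simp: K_def intro!: add_increasing2 sum_nonneg)
    finally show ?thesis .
  next
    case False
    then have "s x \<le> K"
      using s_nonneg by (auto simp: K_def intro!: add_increasing member_le_sum)
    also have "\<dots> \<le> K * (1 + \<bar>of_int x\<bar>)"
      using s_nonneg by (auto simp: K_def algebra_simps intro!: sum_nonneg mult_nonneg_nonneg add_nonneg_nonneg)
    finally show ?thesis .
  qed
  with entry that show ?thesis
    using order_trans by meson
qed

theorem theorem2p3:
  fixes n :: nat
  assumes "n \<ge> 1"
  shows "\<exists>c>0. \<forall>a :: int \<Rightarrow> int \<Rightarrow> complex.
    hermitian_matrix a \<longrightarrow> nJ_matrix n a \<longrightarrow>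
    Limsup (filtercomap (\<lambda>x::int. \<bar>x\<bar>) at_top)
      (\<lambda>x. ereal (1 / japanese_bracket (of_int x) * (\<Sum>\<^sub>\<infinity>y. cmod (a x y)))) \<le> ereal c \<longrightarrow>
    essentially_self_adjoint (matrix_operator a)"
proof (intro exI[of _ 1] conjI allI impI)
  fix a :: "int \<Rightarrow> int \<Rightarrow> complex"
  assume a: "hermitian_matrix a" "nJ_matrix n a"
    and lim: "Limsup (filtercomap (\<lambda>x::int. \<bar>x\<bar>) at_top)
      (\<lambda>x. ereal (1 / japanese_bracket (of_int x) * (\<Sum>\<^sub>\<infinity>y. cmod (a x y)))) \<le> ereal 1"
  \<comment> \<open>The threshold 1 is an arbitrary choice: a growth constant \<open>K\<close>
    exists for every real bound on the limsup.\<close>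
  obtain K where "\<And>x y. cmod (a x y) \<le> K * (1 + \<bar>of_int x\<bar>)"
    using growth_from_Limsup[OF a(2) lim] by blast
  with a interpret linear_growth_band n a K
    by unfold_locales
  show "essentially_self_adjoint (matrix_operator a)"
    by (rule essentially_self_adjoint_matrix_operator)
qed simp

end
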